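(* Let $\zeta$ be the Riemann zeta function and $B_n$ the $n$-th Bernoulli number. Then the following three formulas hold. (i) For every integer $n\ge 0$, $$\zeta(2n)=(-1)^{n-1}\frac{2^{2n-1}}{(2n)!}\pi^{2n}B_{2n}.$$ (ii) For every integer $n\ge 1$, $$\zeta\left(n-\frac12\right)=\frac{2^{n}\int_{1}^{\infty}\frac{(\ln y)^{n-\frac12}}{(1+y)^2}\,dy}{\sqrt{\pi}\,(2n-1)!!\,\left(1-2^{-\frac{2n-3}{2}}\right)}.$$ (iii) For every integer $n>1$, $$\zeta(n)=\frac{(1-2^{1-n})^{-1}}{n!}\int_{0}^{\infty}\frac{x^n e^{-x}}{(1+e^{-x})^2}\,dx.$$
   Context: $\zeta$ denotes the Riemann zeta function, $\zeta(s)=\sum_{n\ge1}n^{-s}$ for $\operatorname{Re}(s)>1$, continued meromorphically to the whole complex plane with only a simple pole at $s=1$ (residue $1$); for $\operatorname{Re}(s)>0$, $s\ne1$, it is given by $\zeta(s)=\frac{1}{1-2^{1-s}}\sum_{n\ge1}\frac{(-1)^{n+1}}{n^s}$ (where $1-2^{1-s}\neq 0$). The Bernoulli numbers are $B_n=B_n(0)$, where $\frac{te^{tx}}{e^t-1}=\sum_{n=0}^\infty B_n(x)\frac{t^n}{n!}$ for $|t|<2\pi$; thus $B_0=1$, $B_1=-\frac12$, $B_2=\frac16$, $B_4=-\frac1{30}$, and so on. $(2n-1)!!=1\cdot3\cdots(2n-1)$. *)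

theory Defs
  imports "HOL-Complex_Analysis.Complex_Analysis"
begin

(* The analytic continuation of the Dirichlet series to the plane minus the point 1; by the
   identity theorem it is uniquely determined there.  The pole of zeta at 1 is not recorded
   in the type, so the value zeta 1 is arbitrary. *)
definition zeta :: "complex \<Rightarrow> complex" where
  "zeta = (SOME f. f holomorphic_on (- {1}) \<and>
     (\<forall>s. Re s > 1 \<longrightarrow> f s = (\<Sum>n. 1 / of_nat (Suc n) powr s)))"

(* n! times the n-th Taylor coefficient of t e^(t x) / (e^t - 1).  The quotient is formed in
   the ring of formal power series, where the common factor t is cancelled. *)
definition bernoulli_poly :: "nat \<Rightarrow> real \<Rightarrow> real" where
  "bernoulli_poly n x = fact n * fps_nth (fps_X * fps_exp x / (fps_exp 1 - 1)) n"

definition bernoulli :: "nat \<Rightarrow> real" where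
  "bernoulli n = bernoulli_poly n 0"

end

theory Submission
  imports Defs
begin

text \<open>
  The analytic continuation and parts (ii) and (iii) rest on two integral representations of \<open>\<zeta>\<close>,
  both obtained by expanding an exponential kernel into a geometric-type series and integrating
  termwise against a power of \<open>x\<close>, where each term contributes a Gamma integral.

  The kernel \<open>1 / (exp x - 1)\<close> gives \<open>\<Gamma>(s) \<zeta>(s)\<close> for \<open>Re s > 1\<close>, and this representation supplies
  the analytic continuation. On \<open>{1<..}\<close> the integral is entire in \<open>s\<close>. On \<open>{0<..1}\<close> the
  kernel is expanded as \<open>\<Sum>k. c k * x ^ (k - 1)\<close> with \<open>c k = B k / k!\<close>, which is possible because that
  series converges for \<open>\<bar>x\<bar> < 2 * pi\<close>; integrating gives \<open>\<Sum>k. c k / (s + k - 1)\<close>. After division by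
  \<open>\<Gamma>(s)\<close> the poles of this series at \<open>0, -1, -2, \<dots>\<close> are cancelled by zeros of \<open>1 / \<Gamma>\<close>, so only the one
  at \<open>1\<close> survives (\<open>zeta_cont_holomorphic\<close>). The domain being connected, \<open>\<zeta>\<close> is this function. At
  \<open>s = 0\<close> every contribution but \<open>c 1 = -1/2\<close> vanishes, which is part (i) for \<open>n = 0\<close>.

  For \<open>n \<ge> 1\<close>, part (i) is a comparison of Taylor coefficients. The coefficients of the Digamma function
  at \<open>1\<close> are, up to sign, the sums of inverse powers of the positive integers; the reflection formula turns
  \<open>z (\<psi>(1 + z) - \<psi>(1 - z))\<close> into \<open>1 - \<pi> z cot (\<pi> z)\<close>; and writing the cotangent with exponentials makes
  this \<open>1 - \<pi> \<i> z - w / (exp w - 1)\<close> with \<open>w = 2 \<pi> \<i> z\<close>, the generating function of the Bernoulli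
  numbers (\<open>Digamma_bern_identity\<close>).

  The kernel \<open>exp (-x) / (1 + exp (-x))\<^sup>2\<close> gives \<open>\<Gamma>(s + 1) (1 - 2 powr (1 - s)) \<zeta>(s)\<close>, because its
  expansion is the alternating series \<open>\<Sum>k. (-1) ^ k * (k + 1) * exp (-(k + 1) x)\<close>. The termwise
  integration needs \<open>Re s > 1\<close>, but both sides are holomorphic for \<open>Re s > -1\<close>, \<open>s \<noteq> 1\<close>, so the identity
  persists there (\<open>logistic_moment\<close>); this wider range is what covers \<open>\<zeta>(1/2)\<close>. Part (iii) is the
  case \<open>s = n\<close>. Part (ii) is the case \<open>s = n - 1/2\<close> after the substitution \<open>y = exp x\<close>, with
  \<open>\<Gamma>(n + 1/2) = sqrt \<pi> (2n - 1)!! / 2 ^ n\<close>.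
\<close>

section \<open>Termwise integration and Mellin transforms\<close>

text \<open>Fubini for a series and an integral over a set, in the form of dominated convergence: summability of
  the \<open>L1\<close> norms is enough.\<close>
lemma set_integral_sums:
  fixes f :: "nat \<Rightarrow> 'a \<Rightarrow> 'b::{banach, second_countable_topology}"
  assumes int: "\<And>i. set_integrable M A (f i)"
  assumes sums: "\<And>x. x \<in> A \<Longrightarrow> (\<lambda>i. f i x) sums g x"
  assumes norm: "\<And>x. x \<in> A \<Longrightarrow> summable (\<lambda>i. norm (f i x))"
  assumes sum: "summable (\<lambda>i. LINT x:A|M. norm (f i x))"
  shows "set_integrable M A g" and "(\<lambda>i. LINT x:A|M. f i x) sums (LINT x:A|M. g x)"
proof -
  let ?f = "\<lambda>i x. indicator A x *\<^sub>R f i x"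
  have eq: "(\<lambda>x. \<Sum>i. ?f i x) = (\<lambda>x. indicator A x *\<^sub>R g x)"
    using sums by (auto simp: fun_eq_iff indicator_def sums_iff)
  have 1: "integrable M (?f i)" for i
    using int[of i] by (simp add: set_integrable_def)
  have 2: "AE x in M. summable (\<lambda>i. norm (?f i x))"
    using norm by (auto simp: indicator_def)
  have "(\<lambda>i. \<integral>x. norm (?f i x) \<partial>M) = (\<lambda>i. LINT x:A|M. norm (f i x))"
    by (auto simp: set_lebesgue_integral_def)
  hence 3: "summable (\<lambda>i. \<integral>x. norm (?f i x) \<partial>M)"
    using sum by simp
  show "set_integrable M A g"
    using integrable_suminf[OF 1 2 3] unfolding eq set_integrable_def .
  show "(\<lambda>i. LINT x:A|M. f i x) sums (LINT x:A|M. g x)"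
    using sums_integral[OF 1 2 3] unfolding eq set_lebesgue_integral_def .
qed

lemma continuous_on_powr_of_real:
  fixes s :: complex
  assumes "A \<subseteq> {0<..}"
  shows "continuous_on A (\<lambda>x::real. of_real x powr s)"
  using assms by (intro continuous_intros) (auto simp: complex_nonpos_Reals_iff)

lemma norm_powr_of_real: "x > 0 \<Longrightarrow> norm (complex_of_real x powr s) = x powr Re s"
  by (simp add: norm_powr_real_powr)

text \<open>Euler's integral for \<open>\<Gamma>(s)\<close> after the rescaling \<open>x \<mapsto> a * x\<close>.\<close>
lemma gamma_integral_scaled:
  fixes s :: complex and a :: real
  assumes s: "Re s > 0" and a: "a > 0"
  shows "set_integrable lborel {0<..} (\<lambda>x. of_real x powr (s - 1) * of_real (exp (- a * x)))"
    and "(LBINT x:{0<..}. of_real x powr (s - 1) * of_real (exp (- a * x))) = Gamma s / of_real a powr s"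
proof -
  define f where "f = (\<lambda>a x::real. complex_of_real x powr (s - 1) * of_real (exp (- a * x)))"
  have meas: "(\<lambda>x. indicator {0<..} x *\<^sub>R f a x) \<in> borel_measurable borel" for a
    unfolding f_def
    by (intro borel_measurable_continuous_on_indicator continuous_intros continuous_on_powr_of_real) auto
  have int: "set_integrable lborel {0<..} (f a)" if "a > 0" for a
  proof -
    have "set_integrable lebesgue {0<..} (f a)"
      using absolutely_integrable_Gamma_integral[OF s that]
      by (simp add: f_def divide_inverse exp_minus)
    thus ?thesis
      using meas unfolding set_integrable_def by (subst (asm) integrable_completion) auto
  qed
  have one: "(LBINT x:{0<..}. f 1 x) = Gamma s"
  proof -
    have "(LBINT x:{0<..}. f 1 x) = integral {0<..} (f 1)"
      by (intro set_borel_integral_eq_integral(2) int) auto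
    also have "\<dots> = Gamma s"
      using Gamma_integral_complex'[OF s] by (intro integral_unique) (simp add: f_def divide_inverse exp_minus)
    finally show ?thesis .
  qed
  have "Gamma s = (\<integral>x. indicator {0<..} x *\<^sub>R f 1 x \<partial>lborel)"
    using one by (simp add: set_lebesgue_integral_def)
  also have "\<dots> = a *\<^sub>R (\<integral>x. indicator {0<..} (0 + a * x) *\<^sub>R f 1 (0 + a * x) \<partial>lborel)"
    using a by (subst lborel_integral_real_affine[of a _ 0]) auto
  also have "(\<lambda>x. indicator {0<..} (0 + a * x) *\<^sub>R f 1 (0 + a * x)) =
             (\<lambda>x. of_real a powr (s - 1) * (indicator {0<..} x *\<^sub>R f a x))"
    using a by (auto simp: fun_eq_iff indicator_def f_def zero_less_mult_iff powr_times_real)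
  also have "a *\<^sub>R (\<integral>x. of_real a powr (s - 1) * (indicator {0<..} x *\<^sub>R f a x) \<partial>lborel) =
      (of_real a * of_real a powr (s - 1)) * (LBINT x:{0<..}. f a x)"
    by (simp add: set_lebesgue_integral_def scaleR_conv_of_real)
  also have "of_real a * of_real a powr (s - 1) = complex_of_real a powr s"
    using a by (simp add: powr_diff)
  finally have "Gamma s = of_real a powr s * (LBINT x:{0<..}. f a x)" .
  thus "(LBINT x:{0<..}. of_real x powr (s - 1) * of_real (exp (- a * x))) = Gamma s / of_real a powr s"
    using a by (auto simp: f_def field_simps)
  show "set_integrable lborel {0<..} (\<lambda>x. of_real x powr (s - 1) * of_real (exp (- a * x)))"
    using int[OF a] by (simp add: f_def)
qed

lemma gamma_integral_scaled_real:
  fixes s a :: real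
  assumes s: "s > 0" and a: "a > 0"
  shows "set_integrable lborel {0<..} (\<lambda>x. x powr (s - 1) * exp (- a * x))"
    and "(LBINT x:{0<..}. x powr (s - 1) * exp (- a * x)) = Gamma s / a powr s"
proof -
  have eq: "complex_of_real x powr (of_real s - 1) * of_real (exp (- a * x)) =
     of_real (x powr (s - 1) * exp (- a * x))" if "x \<in> {0<..}" for x
    using that powr_of_real[of x "s - 1"] by simp
  have "set_integrable lborel {0<..} (\<lambda>x. complex_of_real (x powr (s - 1) * exp (- a * x)))"
    using gamma_integral_scaled(1)[of "of_real s" a] s a
    by (subst set_integrable_cong[OF refl refl eq[symmetric]]) auto
  thus "set_integrable lborel {0<..} (\<lambda>x. x powr (s - 1) * exp (- a * x))"
    unfolding set_integrable_def by (auto dest: integrable_Re)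
  have "complex_of_real (LBINT x:{0<..}. x powr (s - 1) * exp (- a * x)) =
     (LBINT x:{0<..}. complex_of_real x powr (of_real s - 1) * of_real (exp (- a * x)))"
    unfolding set_integral_complex_of_real[symmetric]
    by (intro set_lebesgue_integral_cong) (auto simp: powr_of_real[of _ "s - 1", symmetric])
  also have "\<dots> = of_real (Gamma s / a powr s)"
    using gamma_integral_scaled(2)[of "of_real s" a] s a
    by (simp add: Gamma_complex_of_real powr_of_real)
  finally show "(LBINT x:{0<..}. x powr (s - 1) * exp (- a * x)) = Gamma s / a powr s"
    unfolding of_real_eq_iff .
qed

text \<open>A Mellin transform is holomorphic wherever it converges absolutely. Around a point \<open>s\<close>, expand
  \<open>x powr (w - s)\<close> as the exponential series in \<open>ln x * (w - s)\<close> and integrate termwise: this exhibits the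
  transform as a power series in \<open>w - s\<close>. With \<open>d = \<bar>w - s\<bar>\<close>, the sum of the absolute values of the terms is
  \<open>exp (d * \<bar>ln x\<bar>)\<close> times the integrand, which is at most the sum of the integrands at the real exponents
  \<open>Re s - d\<close> and \<open>Re s + d\<close>.\<close>
lemma mellin_holomorphic:
  fixes g :: "real \<Rightarrow> real"
  assumes A: "A \<in> sets borel" "A \<subseteq> {0<..}"
  assumes int: "\<And>a. a > \<alpha> \<Longrightarrow> set_integrable lborel A (\<lambda>x. x powr (a - 1) * g x)"
  shows "(\<lambda>s::complex. LBINT x:A. of_real x powr (s - 1) * of_real (g x)) holomorphic_on {s. Re s > \<alpha>}"
proof -
  define I where "I = (\<lambda>s::complex. LBINT x:A. of_real x powr (s - 1) * of_real (g x))"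
  \<comment> \<open>Measurability of \<open>g\<close> on \<open>A\<close> is extracted from the integrability assumption.\<close>
  have meas: "set_borel_measurable borel A (\<lambda>x. complex_of_real x powr s * of_real (g x))" for s
  proof -
    have "set_borel_measurable borel A (\<lambda>x. of_real x powr s)"
      unfolding set_borel_measurable_def using A
      by (intro borel_measurable_continuous_on_indicator continuous_on_powr_of_real) auto
    moreover have "(\<lambda>x. indicator A x *\<^sub>R g x) \<in> borel_measurable borel"
    proof -
      have "(\<lambda>x. indicator A x *\<^sub>R (x powr \<alpha> * g x)) \<in> borel_measurable borel"
        using borel_measurable_integrable[OF int[of "\<alpha> + 1", unfolded set_integrable_def]] by simp
      hence "(\<lambda>x. x powr (-\<alpha>) * (indicator A x *\<^sub>R (x powr \<alpha> * g x))) \<in> borel_measurable borel"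
        by measurable
      also have "(\<lambda>x. x powr (-\<alpha>) * (indicator A x *\<^sub>R (x powr \<alpha> * g x))) = (\<lambda>x. indicator A x *\<^sub>R g x)"
        using A(2) by (force simp: fun_eq_iff indicator_def powr_minus)
      finally show ?thesis .
    qed
    ultimately have "(\<lambda>x. (indicator A x *\<^sub>R (complex_of_real x powr s)) * of_real (indicator A x *\<^sub>R g x)) \<in> borel_measurable borel"
      unfolding set_borel_measurable_def by measurable
    also have "(\<lambda>x. (indicator A x *\<^sub>R (complex_of_real x powr s)) * of_real (indicator A x *\<^sub>R g x)) =
        (\<lambda>x. indicator A x *\<^sub>R (complex_of_real x powr s * of_real (g x)))"
      by (auto simp: indicator_def fun_eq_iff)
    finally show ?thesis by (simp add: set_borel_measurable_def)
  qed
  have "I holomorphic_on ball s (Re s - \<alpha>)" if s: "Re s > \<alpha>" for s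
  proof (rule power_series_holomorphic)
    fix w assume w: "w \<in> ball s (Re s - \<alpha>)"
    define d where "d = norm (w - s)"
    have d: "d \<ge> 0" "\<alpha> < Re s - d" using w s by (auto simp: d_def dist_norm norm_minus_commute)
    let ?a = "\<lambda>n. LBINT x:A. of_real (ln x) ^ n / fact n * (of_real x powr (s - 1) * of_real (g x))"
    let ?f = "\<lambda>n x. of_real (ln x) ^ n / fact n * (of_real x powr (s - 1) * of_real (g x)) * (w - s) ^ n"
    \<comment> \<open>dominates all partial sums of the norms of the terms\<close>
    let ?h = "\<lambda>x. (x powr (Re s - d - 1) * \<bar>g x\<bar> + x powr (Re s + d - 1) * \<bar>g x\<bar>)"
    have h: "set_integrable lborel A ?h"
      using set_integrable_abs[OF int[of "Re s - d"]] set_integrable_abs[OF int[of "Re s + d"]] d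
      by (intro set_integral_add) (auto simp: abs_mult)
    have normf: "norm (?f n x) = (d * \<bar>ln x\<bar>) ^ n / fact n * (x powr (Re s - 1) * \<bar>g x\<bar>)" if "x \<in> A" for n x
      using that A(2) by (auto simp: norm_mult norm_power norm_divide d_def norm_powr_of_real field_simps)
    have sumn: "(\<lambda>n. norm (?f n x)) sums (exp (d * \<bar>ln x\<bar>) * (x powr (Re s - 1) * \<bar>g x\<bar>))" if "x \<in> A" for x
      unfolding normf[OF that] 
      by (intro sums_mult2) (use exp_converges[of "d * \<bar>ln x\<bar>"] in \<open>simp add: field_simps\<close>)
    have dom: "exp (d * \<bar>ln x\<bar>) * (x powr (Re s - 1) * \<bar>g x\<bar>) \<le> ?h x" if "x \<in> A" for x
    proof -
      have x: "x > 0" using that A(2) by auto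
      have "exp (d * \<bar>ln x\<bar>) \<le> x powr (-d) + x powr d"
        using x by (cases "ln x \<ge> 0") (auto simp: powr_def)
      hence "exp (d * \<bar>ln x\<bar>) * (x powr (Re s - 1) * \<bar>g x\<bar>) \<le> (x powr (-d) + x powr d) * (x powr (Re s - 1) * \<bar>g x\<bar>)"
        by (intro mult_right_mono) auto
      also have "\<dots> = ?h x" using x by (simp add: algebra_simps flip: powr_add)
      finally show ?thesis .
    qed
    have int_f: "set_integrable lborel A (?f n)" for n
    proof (rule set_integrable_bound[OF h])
      have "(\<lambda>x. of_real (ln x) ^ n / fact n * (w - s) ^ n * (indicator A x *\<^sub>R (complex_of_real x powr (s-1) * of_real (g x)))) \<in> borel_measurable lborel"
        using meas[of "s-1"] unfolding set_borel_measurable_def by measurable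
      thus "set_borel_measurable lborel A (?f n)"
        unfolding set_borel_measurable_def by (simp add: mult_ac scaleR_conv_of_real)
      have "norm (?f n x) \<le> ?h x" if "x \<in> A" for x
      proof -
        have "norm (?f n x) \<le> (\<Sum>n. norm (?f n x))"
          using sum_le_suminf[OF sums_summable[OF sumn[OF that]], of "{n}"] by simp
        also have "\<dots> \<le> ?h x" using sumn[OF that] dom[OF that] by (simp add: sums_iff)
        finally show ?thesis .
      qed
      thus "AE x in lborel. x \<in> A \<longrightarrow> norm (?f n x) \<le> norm (?h x)"
        by (intro always_eventually) force
    qed
    have "summable (\<lambda>n. LBINT x:A. norm (?f n x))"
    proof (rule summableI_nonneg_bounded)
      show "(LBINT x:A. norm (?f n x)) \<ge> 0" for n
        by (auto simp: set_lebesgue_integral_def)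
      fix N
      have "(\<Sum>n<N. LBINT x:A. norm (?f n x)) = (LBINT x:A. \<Sum>n<N. norm (?f n x))"
        unfolding set_lebesgue_integral_def scaleR_sum_right
        using set_integrable_norm[OF int_f] unfolding set_integrable_def
        by (subst Bochner_Integration.integral_sum) auto
      also have "\<dots> \<le> (LBINT x:A. ?h x)"
      proof (rule set_integral_mono)
        show "set_integrable lborel A (\<lambda>x. \<Sum>n<N. norm (?f n x))"
          using set_integrable_norm[OF int_f] unfolding set_integrable_def scaleR_sum_right
          by (intro Bochner_Integration.integrable_sum) auto
        fix x assume x: "x \<in> A"
        have "(\<Sum>n<N. norm (?f n x)) \<le> (\<Sum>n. norm (?f n x))"
          by (intro sum_le_suminf sums_summable[OF sumn[OF x]]) auto
        also have "\<dots> \<le> ?h x" using sumn[OF x] dom[OF x] by (simp add: sums_iff)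
        finally show "(\<Sum>n<N. norm (?f n x)) \<le> ?h x" .
      qed fact
      finally show "(\<Sum>n<N. LBINT x:A. norm (?f n x)) \<le> (LBINT x:A. ?h x)" .
    qed
    moreover have "(\<lambda>n. ?f n x) sums (of_real x powr (w - 1) * of_real (g x))" if "x \<in> A" for x
    proof -
      have x: "x > 0" using that A(2) by auto
      have "(\<lambda>n. (of_real (ln x) * (w - s)) ^ n /\<^sub>R fact n) sums exp (of_real (ln x) * (w - s))"
        by (rule exp_converges)
      from sums_mult2[OF this, of "of_real x powr (s - 1) * of_real (g x)"]
      moreover have "exp (of_real (ln x) * (w - s)) * (of_real x powr (s - 1) * of_real (g x)) =
                     of_real x powr (w - 1) * of_real (g x)"
        using x by (simp add: powr_def Ln_of_real algebra_simps flip: exp_add)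
      ultimately have "(\<lambda>n. (of_real (ln x) * (w - s)) ^ n /\<^sub>R fact n * (of_real x powr (s - 1) * of_real (g x)))
          sums (of_real x powr (w - 1) * of_real (g x))"
        by (simp only:)
      thus ?thesis
        by (simp add: scaleR_conv_of_real power_mult_distrib divide_inverse mult_ac)
    qed
    moreover have "summable (\<lambda>n. norm (?f n x))" if "x \<in> A" for x
      by (rule sums_summable[OF sumn[OF that]])
    ultimately have "(\<lambda>n. LBINT x:A. ?f n x) sums (I w)"
      unfolding I_def using A int_f by (intro set_integral_sums(2)) simp_all
    thus "(\<lambda>n. ?a n * (w - s) ^ n) sums I w" by simp
  qed
  hence "\<exists>e>0. I holomorphic_on ball s e" if "Re s > \<alpha>" for s
    using that by (intro exI[of _ "Re s - \<alpha>"]) auto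
  hence "I analytic_on {s. Re s > \<alpha>}" by (auto simp: analytic_on_def)
  thus ?thesis unfolding I_def by (rule analytic_imp_holomorphic)
qed

section \<open>The Bernoulli generating function and sums of inverse even powers\<close>

text \<open>The complex counterpart of the real series that defines the Bernoulli numbers; its \<open>n\<close>-th coefficient
  is \<open>B n / n!\<close>.\<close>
definition bern_fps :: "complex fps" where
  "bern_fps = fps_X / (fps_exp 1 - 1)"

lemma subdegree_fps_exp_minus_1: "subdegree (fps_exp (1::'a::field_char_0) - 1) = 1"
  by (rule subdegreeI) auto

lemma bern_fps_mult: "(fps_X / (fps_exp (1::'a::field_char_0) - 1)) * (fps_exp 1 - 1) = fps_X"
proof -
  have "fps_exp (1::'a) - 1 \<noteq> 0"
    using subdegree_fps_exp_minus_1[where ?'a = 'a] by auto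
  hence "fps_exp (1::'a) - 1 dvd fps_X"
    using subdegree_fps_exp_minus_1[where ?'a = 'a] by (simp add: fps_dvd_iff)
  thus ?thesis by (rule dvd_div_mult_self)
qed

text \<open>The real coefficients, read as complex numbers, satisfy the equation that determines \<open>bern_fps\<close>:
  multiplied by \<open>exp - 1\<close> they give \<open>X\<close>.\<close>
lemma bernoulli_conv_bern_fps: "complex_of_real (bernoulli n) = fact n * fps_nth bern_fps n"
proof -
  define B :: "real fps" where "B = fps_X / (fps_exp 1 - 1)"
  define C :: "complex fps" where "C = Abs_fps (\<lambda>n. of_real (fps_nth B n))"
  have "C * (fps_exp 1 - 1) = fps_X"
  proof (rule fps_ext)
    fix n
    have "fps_nth (C * (fps_exp 1 - 1)) n = of_real (fps_nth (B * (fps_exp 1 - 1)) n)"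
      by (auto simp: fps_mult_nth C_def intro!: sum.cong)
    also have "\<dots> = fps_nth fps_X n"
      unfolding B_def bern_fps_mult by (simp add: fps_X_def)
    finally show "fps_nth (C * (fps_exp 1 - 1)) n = fps_nth fps_X n" .
  qed
  moreover have "fps_exp (1::complex) - 1 \<noteq> 0"
    using subdegree_fps_exp_minus_1[where ?'a = complex] by auto
  ultimately have eq: "bern_fps = C"
    unfolding bern_fps_def by (metis nonzero_mult_div_cancel_right)
  have "fps_nth bern_fps n = of_real (fps_nth B n)"
    unfolding eq C_def by simp
  moreover have "bernoulli n = fact n * fps_nth B n"
    by (simp add: bernoulli_def bernoulli_poly_def B_def)
  ultimately show ?thesis by simp
qed

lemma bern_fps_0: "fps_nth bern_fps 0 = 1" and bern_fps_1: "fps_nth bern_fps 1 = - 1 / 2"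
proof -
  have *: "fps_nth (bern_fps * (fps_exp 1 - 1)) n = fps_nth fps_X n" for n
    unfolding bern_fps_def bern_fps_mult ..
  show 0: "fps_nth bern_fps 0 = 1"
    using *[of 1] by (simp add: fps_mult_nth)
  show "fps_nth bern_fps 1 = - 1 / 2"
    using *[of 2] 0 by (simp add: fps_mult_nth numeral_2_eq_2 eq_neg_iff_add_eq_0 add.commute)
qed

text \<open>The nonzero periods of \<open>exp\<close> have modulus at least \<open>2 * pi\<close>; this fixes the radius of convergence of
  \<open>bern_fps\<close>.\<close>
lemma exp_ne_1_small:
  assumes "norm (z::complex) < 2 * pi" "z \<noteq> 0" shows "exp z \<noteq> 1"
proof
  assume "exp z = 1"
  then obtain n :: int where n: "Re z = 0" "Im z = of_int (2 * n) * pi"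
    by (auto simp: exp_eq_1)
  have "\<bar>Im z\<bar> < 2 * pi" using assms(1) abs_Im_le_cmod[of z] by linarith
  hence "\<bar>real_of_int n\<bar> < 1" using n by (simp add: abs_mult)
  hence "n = 0" by linarith
  thus False using n assms(2) by (auto simp: complex_eq_iff)
qed

lemma fps_conv_radius_bern_fps: "fps_conv_radius bern_fps \<ge> 2 * pi"
  and eval_bern_fps: "norm z < 2 * pi \<Longrightarrow> eval_fps bern_fps z = (if z = 0 then 1 else z / (exp z - 1))"
proof -
  have sub: "subdegree (fps_exp 1 - 1 :: complex fps) = Suc 0"
    using subdegree_fps_exp_minus_1[where ?'a = complex] by simp
  have radius: "fps_conv_radius (fps_exp 1 - 1 :: complex fps) = \<infinity>"
    using fps_conv_radius_diff[of "fps_exp 1 :: complex fps" 1] by simp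
  have eval: "eval_fps (fps_exp 1 - 1) z = exp z - 1" for z :: complex
    by (subst eval_fps_diff) auto
  have nz: "eval_fps (fps_exp 1 - 1) z \<noteq> 0" if "z \<in> eball 0 (2 * pi)" "z \<noteq> 0" for z :: complex
    using exp_ne_1_small[of z] that by (simp add: eval)
  note 1 = fps_conv_radius_divide[of "fps_exp 1 - 1 :: complex fps" fps_X "2 * pi"]
  note 2 = eval_fps_divide[of "fps_exp 1 - 1 :: complex fps" fps_X "2 * pi" z "1"]
  show "fps_conv_radius bern_fps \<ge> 2 * pi"
    using 1 nz unfolding bern_fps_def by (auto simp add: radius sub simp del: subdegree_minus_commute)
  show "eval_fps bern_fps z = (if z = 0 then 1 else z / (exp z - 1))" if "norm z < 2 * pi"
    using 2 nz that unfolding bern_fps_def by (auto simp add: radius sub eval simp del: subdegree_minus_commute)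
qed

lemma has_fps_expansion_bern:
  "(\<lambda>z. if z = 0 then 1 else z / (exp z - 1)) has_fps_expansion bern_fps"
proof -
  have "(0::ereal) < 2 * pi" by simp
  hence "fps_conv_radius bern_fps > 0"
    using fps_conv_radius_bern_fps order_less_le_trans by blast
  moreover have "eventually (\<lambda>z::complex. z \<in> ball 0 (2 * pi)) (nhds 0)"
    by (intro eventually_nhds_in_open) auto
  hence "eventually (\<lambda>z. eval_fps bern_fps z = (if z = 0 then 1 else z / (exp z - 1))) (nhds 0)"
    by eventually_elim (simp add: eval_bern_fps)
  ultimately show ?thesis by (simp add: has_fps_expansion_def)
qed

text \<open>Logarithmic differentiation of the reflection formula of \<open>\<Gamma>\<close>, carried out for the entire function
  \<open>1 / \<Gamma>\<close>.\<close>
lemma Digamma_reflection: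
  fixes z :: complex
  assumes "z \<notin> \<int>"
  shows "(Digamma (1 - z) - Digamma z) * sin (of_real pi * z) = of_real pi * cos (of_real pi * z)"
proof -
  have z: "z \<notin> \<int>\<^sub>\<le>\<^sub>0" "1 - z \<notin> \<int>\<^sub>\<le>\<^sub>0"
    using assms nonpos_Ints_Int[of "1 - z"] Ints_diff[of 1 "1 - z"] by (auto dest: nonpos_Ints_Int)
  have "((\<lambda>z. rGamma z * rGamma (1 - z)) has_field_derivative
          (rGamma z * rGamma (1 - z)) * (Digamma (1 - z) - Digamma z)) (at z)"
    using z by (auto intro!: derivative_eq_intros simp: algebra_simps)
  moreover have "((\<lambda>z. sin (of_real pi * z) / of_real pi) has_field_derivative
          cos (of_real pi * z)) (at z)"
    by (auto intro!: derivative_eq_intros)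
  ultimately have "(sin (of_real pi * z) / of_real pi) * (Digamma (1 - z) - Digamma z) = cos (of_real pi * z)"
    unfolding rGamma_reflection_complex by (rule DERIV_unique)
  thus ?thesis by (simp add: field_simps)
qed

text \<open>With \<open>e = exp (\<i> * pi * z)\<close>, the cotangent in the reflection formula is
  \<open>\<i> * (e\<^sup>2 + 1) / (e\<^sup>2 - 1) = \<i> + 2 * \<i> / (e\<^sup>2 - 1)\<close>, and \<open>e\<^sup>2 = exp w\<close>.\<close>
lemma Digamma_bern_identity:
  fixes z :: complex
  assumes z: "norm z < 1"
  shows "z * (Digamma (1 + z) - Digamma (1 - z)) =
     1 - of_real pi * \<i> * z - (let w = 2 * of_real pi * \<i> * z in if w = 0 then 1 else w / (exp w - 1))"
proof (cases "z = 0")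
  case False
  have zi: "z \<notin> \<int>" using False z by (auto elim!: Ints_cases)
  define e where "e = exp (\<i> * of_real pi * z)"
  define w where "w = 2 * of_real pi * \<i> * z"
  have e: "e \<noteq> 0" by (simp add: e_def)
  have ew: "exp w = e ^ 2"
    by (simp add: e_def w_def algebra_simps flip: exp_of_nat_mult)
  have "norm w < 2 * pi" "w \<noteq> 0" using z False by (auto simp: w_def norm_mult)
  hence e1: "e ^ 2 \<noteq> 1" using exp_ne_1_small[of w] by (simp add: ew)
  have cos: "cos (of_real pi * z) = (e + inverse e) / 2"
    by (simp add: cos_exp_eq e_def exp_minus mult_ac)
  have sin: "sin (of_real pi * z) = (e - inverse e) / (2 * \<i>)"
    by (simp add: sin_exp_eq e_def exp_minus mult_ac)
  have sin0: "e - inverse e \<noteq> 0" using e e1 by (auto simp: field_simps power2_eq_square)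
  have "Digamma (1 - z) - Digamma z = of_real pi * cos (of_real pi * z) / sin (of_real pi * z)"
    using Digamma_reflection[OF zi] sin0 by (subst eq_divide_eq) (simp add: sin)
  also have "\<dots> = of_real pi * \<i> * (e + inverse e) / (e - inverse e)"
  proof -
    have "p * (u / 2) / (v / (2 * \<i>)) = p * \<i> * u / v" for p u v :: complex
      by (cases "v = 0") (simp_all add: divide_simps)
    thus ?thesis unfolding sin cos by this
  qed
  also have "\<dots> = of_real pi * \<i> * (e ^ 2 + 1) / (e ^ 2 - 1)"
  proof -
    have "(e + inverse e) / (e - inverse e) = (e * (e + inverse e)) / (e * (e - inverse e))"
      using e by (simp only: mult_divide_mult_cancel_left_if if_False)
    also have "\<dots> = (e ^ 2 + 1) / (e ^ 2 - 1)"
      using e by (simp add: algebra_simps power2_eq_square)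
    finally show ?thesis by (simp only: times_divide_eq_right [symmetric])
  qed
  finally have 1: "Digamma (1 - z) - Digamma z = of_real pi * \<i> * (e ^ 2 + 1) / (e ^ 2 - 1)" .
  have "Digamma (1 + z) = Digamma z + 1 / z" using Digamma_plus1[OF False] by (simp add: add.commute)
  hence "z * (Digamma (1 + z) - Digamma (1 - z)) = 1 - z * (Digamma (1 - z) - Digamma z)"
    using False by (simp add: algebra_simps)
  also have "\<dots> = 1 - of_real pi * \<i> * z - w / (exp w - 1)"
    unfolding 1 ew using e1 by (simp add: w_def divide_simps) (simp add: algebra_simps)
  finally show ?thesis using \<open>w \<noteq> 0\<close> by (simp add: w_def Let_def)
qed auto

text \<open>Euler's evaluation, from the coefficients of \<open>z ^ (2 * m)\<close> on both sides of the preceding identity. In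
  \<open>z * (Digamma (1 + z) - Digamma (1 - z))\<close> the odd coefficients of Digamma are doubled and the even ones
  cancel.\<close>
lemma sum_inverse_even_powers:
  assumes m: "m > 0"
  shows "(\<Sum>k. 1 / of_nat (Suc k) ^ (2 * m)) = - ((2 * of_real pi * \<i>) ^ (2 * m) * fps_nth bern_fps (2 * m) / 2)"
proof -
  define D :: "complex fps" where "D = fps_expansion Digamma 1"
  have D_nth: "fps_nth D n = Polygamma n 1 / fact n" for n
    by (simp add: D_def fps_expansion_def higher_deriv_Polygamma)
  have D: "(\<lambda>z. Digamma (1 + z)) has_fps_expansion D"
    unfolding D_def by (intro analytic_at_imp_has_fps_expansion analytic_on_Polygamma) auto
  have comp: "(\<lambda>z. f (c * z)) has_fps_expansion (fps_compose F (fps_const c * fps_X))" 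
    if "f has_fps_expansion F" for f F and c :: complex
    using has_fps_expansion_compose[OF that, of "\<lambda>z. c * z" "fps_const c * fps_X"]
      has_fps_expansion_cmult_left[OF has_fps_expansion_fps_X, of c]
    by (auto simp: o_def)
  define G where "G = fps_X * (D - fps_compose D (fps_const (-1) * fps_X))"
  define H where "H = 1 - fps_const (of_real pi * \<i>) * fps_X - fps_compose bern_fps (fps_const (2 * of_real pi * \<i>) * fps_X)"
  have G: "(\<lambda>z. z * (Digamma (1 + z) - Digamma (1 - z))) has_fps_expansion G"
    unfolding G_def using comp[OF D, of "-1"] D by (intro fps_expansion_intros) auto
  have H: "(\<lambda>z. 1 - of_real pi * \<i> * z - (let w = 2 * of_real pi * \<i> * z in if w = 0 then 1 else w / (exp w - 1))) has_fps_expansion H"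
    unfolding H_def Let_def
    by (intro fps_expansion_intros comp[OF has_fps_expansion_bern])
  have "eventually (\<lambda>z::complex. z \<in> ball 0 1) (nhds 0)"
    by (intro eventually_nhds_in_open) auto
  hence "eventually (\<lambda>z::complex. z * (Digamma (1 + z) - Digamma (1 - z)) =
     1 - of_real pi * \<i> * z - (let w = 2 * of_real pi * \<i> * z in if w = 0 then 1 else w / (exp w - 1))) (nhds 0)"
    by eventually_elim (rule Digamma_bern_identity, simp)
  hence "(\<lambda>z. z * (Digamma (1 + z) - Digamma (1 - z))) has_fps_expansion H"
    using H by (subst has_fps_expansion_cong) auto
  with G have "G = H" by (rule fps_expansion_unique_complex)
  hence "fps_nth G (2 * m) = fps_nth H (2 * m)" by simp
  moreover have "fps_nth H (2 * m) = - ((2 * of_real pi * \<i>) ^ (2 * m) * fps_nth bern_fps (2 * m))"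
    using m by (simp add: H_def fps_nth_compose_linear)
  moreover have "fps_nth G (2 * m) = 2 * fps_nth D (2 * m - 1)"
    using m by (simp add: G_def fps_nth_compose_linear)
  moreover have "fps_nth D (2 * m - 1) = (\<Sum>k. 1 / of_nat (Suc k) ^ (2 * m))"
    using m by (simp add: D_nth Polygamma_def divide_inverse power_inverse)
  ultimately have *: "2 * (\<Sum>k. 1 / of_nat (Suc k) ^ (2 * m)) = - ((2 * of_real pi * \<i>) ^ (2 * m) * fps_nth bern_fps (2 * m))"
    by simp
  have "x = - (y / 2)" if "2 * x = - y" for x y :: complex
    using that by (simp add: field_simps)
  from this[OF *] show ?thesis .
qed

section \<open>The integral with kernel 1 / (exp x - 1)\<close>

lemma summable_bern_fps: "norm z < 2 * pi \<Longrightarrow> summable (\<lambda>k. norm (fps_nth bern_fps k * z ^ k))"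
  by (rule norm_summable_fps) (rule less_le_trans[OF _ fps_conv_radius_bern_fps], simp)

lemma summable_bern_fps': "summable (\<lambda>k. norm (fps_nth bern_fps k))"
  using summable_bern_fps[of 1] pi_gt3 by simp

lemma bern_fps_sums:
  assumes "norm z < 2 * pi"
  shows "(\<lambda>k. fps_nth bern_fps k * z ^ k) sums (if z = 0 then 1 else z / (exp z - 1))"
  using summable_norm_cancel[OF summable_bern_fps[OF assms]] eval_bern_fps[OF assms]
  by (simp add: eval_fps_def sums_iff)

text \<open>The meromorphic function \<open>rGamma s / (s + of_nat k - 1)\<close> with its removable singularity removed: for
  \<open>k > 0\<close> the pole at \<open>1 - k\<close> is a zero of \<open>rGamma\<close>, and the quotient is written as a product of entire
  functions. Only for \<open>k = 0\<close> does a pole remain, at \<open>1\<close>.\<close>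
definition bern_term :: "nat \<Rightarrow> complex \<Rightarrow> complex" where
  "bern_term k s = (if k = 0 then rGamma s / (s - 1) else pochhammer s (k - 1) * rGamma (s + of_nat k))"

lemma bern_term_eq:
  assumes "s + of_nat k - 1 \<noteq> 0"
  shows "bern_term k s = rGamma s / (s + of_nat k - 1)"
proof (cases k)
  case (Suc j)
  have "rGamma s = pochhammer s (Suc j) * rGamma (s + of_nat (Suc j))"
    by (rule pochhammer_rGamma)
  with assms Suc show ?thesis
    by (simp add: bern_term_def pochhammer_rec' field_simps)
qed (simp add: bern_term_def)

lemma holomorphic_bern_term: "bern_term k holomorphic_on (- {1})"
  unfolding bern_term_def by (cases "k = 0") (auto intro!: holomorphic_intros)

text \<open>On a disc the factor \<open>rGamma\<close> is bounded, and \<open>\<bar>s + k - 1\<bar> \<ge> 1\<close> for all large \<open>k\<close>; so the series is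
  eventually dominated by the coefficients of \<open>bern_fps\<close>, which are summable as \<open>1 < 2 * pi\<close>.\<close>
lemma holomorphic_bern_sum: "(\<lambda>s. \<Sum>k. fps_nth bern_fps k * bern_term k s) holomorphic_on (- {1})"
proof (rule holomorphic_uniform_sequence)
  show "open (- {1::complex})" by auto
  show "(\<lambda>s. \<Sum>k<n. fps_nth bern_fps k * bern_term k s) holomorphic_on (- {1})" for n
    by (intro holomorphic_intros holomorphic_bern_term)
  fix z :: complex assume "z \<in> - {1}"
  then obtain d where d: "d > 0" "cball z d \<subseteq> - {1}"
    using open_contains_cball[of "- {1::complex}"] by auto
  have "compact (rGamma ` cball z d)"
    by (intro compact_continuous_image holomorphic_on_imp_continuous_on holomorphic_rGamma) auto
  then obtain M where M: "\<And>s. s \<in> cball z d \<Longrightarrow> norm (rGamma s) \<le> M"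
    using compact_imp_bounded bounded_iff by (metis imageI)
  have "0 \<le> norm (rGamma z)" by simp
  also have "\<dots> \<le> M" using d by (intro M) auto
  finally have "M \<ge> 0" .
  have "uniform_limit (cball z d) (\<lambda>n s. \<Sum>k<n. fps_nth bern_fps k * bern_term k s)
          (\<lambda>s. \<Sum>k. fps_nth bern_fps k * bern_term k s) sequentially"
  proof (rule Weierstrass_m_test_ev)
    show "summable (\<lambda>k. norm (fps_nth bern_fps k) * M)"
      by (intro summable_mult2 summable_bern_fps')
    obtain N :: nat where N: "real N \<ge> norm z + d + 2" using real_arch_simple by blast
    have "norm (fps_nth bern_fps k * bern_term k s) \<le> norm (fps_nth bern_fps k) * M"
      if k: "k \<ge> N" and s: "s \<in> cball z d" for k s
    proof -
      have "norm s \<le> norm z + d"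
        using s norm_triangle_ineq2[of s z] by (simp add: dist_norm norm_minus_commute)
      hence "real k - 1 - norm s \<ge> 1" using N k by linarith
      moreover have "norm (of_nat k - 1 - (- s)) \<ge> norm (of_nat k - 1 :: complex) - norm (- s)"
        by (rule norm_triangle_ineq2)
      moreover have "norm (of_nat k - 1 :: complex) = \<bar>real k - 1\<bar>"
        by (metis norm_of_real of_real_1 of_real_diff of_real_of_nat_eq)
      ultimately have ge: "norm (s + of_nat k - 1) \<ge> 1" by (simp add: algebra_simps)
      hence "bern_term k s = rGamma s / (s + of_nat k - 1)"
        by (intro bern_term_eq) auto
      hence "norm (bern_term k s) = norm (rGamma s) / norm (s + of_nat k - 1)"
        by (simp add: norm_divide)
      also have "\<dots> \<le> M / 1"
        using M[OF s] ge \<open>M \<ge> 0\<close> by (intro frac_le) auto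
      finally show ?thesis by (simp add: norm_mult mult_left_mono)
    qed
    thus "\<forall>\<^sub>F k in sequentially. \<forall>s\<in>cball z d. norm (fps_nth bern_fps k * bern_term k s) \<le> norm (fps_nth bern_fps k) * M"
      unfolding eventually_sequentially by blast
  qed
  with d show "\<exists>d>0. cball z d \<subseteq> - {1} \<and> uniform_limit (cball z d)
      (\<lambda>n s. \<Sum>k<n. fps_nth bern_fps k * bern_term k s)
      (\<lambda>s. \<Sum>k. fps_nth bern_fps k * bern_term k s) sequentially"
    by blast
qed

lemma has_integral_Icc_imp_Ioc:
  fixes f :: "real \<Rightarrow> 'a::banach"
  assumes "(f has_integral I) {a..b}"
  shows "(f has_integral I) {a<..b}"
proof -
  have "negligible {x \<in> {a..b} - {a<..b}. f x \<noteq> 0}" "negligible {x \<in> {a<..b} - {a..b}. f x \<noteq> 0}"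
    by (auto intro: negligible_subset[of "{a}"])
  from has_integral_spike_set_eq[OF this] assms show ?thesis by simp
qed

text \<open>The terms of the expansion near \<open>0\<close>. The norm of the integrand is the same power with the real part of
  the exponent, so its integral has the same shape.\<close>
lemma integral_powr_unit_interval:
  fixes w :: complex
  assumes w: "Re w > 0"
  shows "set_integrable lborel {0<..1} (\<lambda>x. of_real x powr (w - 1))"
    and "(LBINT x:{0<..1}. of_real x powr (w - 1)) = 1 / w"
    and "(LBINT x:{0<..1}. norm (complex_of_real x powr (w - 1))) = 1 / Re w"
proof -
  define f where "f = (\<lambda>x::real. complex_of_real x powr (w - 1))"
  have real: "((\<lambda>x. x powr (Re w - 1)) has_integral (1 / Re w)) {0..1}"
    using has_integral_powr_from_0[of "Re w - 1" 1] w by simp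
  have "set_integrable lebesgue {0..1} (\<lambda>x. x powr (Re w - 1))"
    using real by (intro nonnegative_absolutely_integrable_1) (auto simp: integrable_on_def)
  hence "set_integrable lborel {0..1} (\<lambda>x. x powr (Re w - 1))"
    unfolding set_integrable_def by (subst (asm) integrable_completion) auto
  hence int_real: "set_integrable lborel {0<..1} (\<lambda>x. x powr (Re w - 1))"
    by (rule set_integrable_subset) auto
  have meas: "set_borel_measurable lborel {0<..1} f"
    unfolding set_borel_measurable_def f_def measurable_lborel2
    by (intro borel_measurable_continuous_on_indicator continuous_on_powr_of_real) auto
  have normf: "norm (f x) = x powr (Re w - 1)" if "x \<in> {0<..1}" for x
    using that by (simp add: f_def norm_powr_of_real)
  show int: "set_integrable lborel {0<..1} f"
    by (rule set_integrable_bound[OF int_real meas]) (use normf in auto)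
  have "((\<lambda>x. of_real x powr (w - 1)) has_integral (of_real 1 powr w / w - of_real 0 powr w / w)) {0..1::real}"
  proof (rule fundamental_theorem_of_calculus_interior)
    show "continuous_on {0..1} (\<lambda>x::real. complex_of_real x powr w / w)"
      using w by (intro continuous_intros) auto
    fix x :: real assume x: "x \<in> {0<..<1}"
    show "((\<lambda>x. complex_of_real x powr w / w) has_vector_derivative complex_of_real x powr (w - 1)) (at x)"
      using x w by (intro has_vector_derivative_real_field)
        (auto intro!: derivative_eq_intros simp: complex_nonpos_Reals_iff)
  qed auto
  hence "(f has_integral (1 / w)) {0..1}" using w by (auto simp: f_def)
  hence "(f has_integral (1 / w)) {0<..1}"
    by (rule has_integral_Icc_imp_Ioc)
  thus "(LBINT x:{0<..1}. f x) = 1 / w"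
    using set_borel_integral_eq_integral(2)[OF int] by (simp add: integral_unique)
  have "(LBINT x:{0<..1}. norm (f x)) = (LBINT x:{0<..1}. x powr (Re w - 1))"
    by (intro set_lebesgue_integral_cong) (use normf in auto)
  also have "((\<lambda>x. x powr (Re w - 1)) has_integral (1 / Re w)) {0<..1}"
    using real by (rule has_integral_Icc_imp_Ioc)
  hence "(LBINT x:{0<..1}. x powr (Re w - 1)) = 1 / Re w"
    using set_borel_integral_eq_integral(2)[OF int_real] by (simp add: integral_unique)
  finally show "(LBINT x:{0<..1}. norm (f x)) = 1 / Re w" .
qed

text \<open>Termwise integration of the Taylor series of \<open>x / (exp x - 1)\<close> against \<open>x powr (s - 2)\<close>; the interval
  lies inside the disc of convergence of the series.\<close>
lemma bose_integral_unit_interval: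
  fixes s :: complex
  assumes s: "Re s > 1"
  shows "set_integrable lborel {0<..1} (\<lambda>x. of_real x powr (s - 1) * of_real (1 / (exp x - 1)))"
    and "(\<lambda>k. fps_nth bern_fps k / (s + of_nat k - 1)) sums
           (LBINT x:{0<..1}. of_real x powr (s - 1) * of_real (1 / (exp x - 1)))"
proof -
  let ?f = "\<lambda>k x. fps_nth bern_fps k * complex_of_real x powr ((s + of_nat k - 1) - 1)"
  let ?g = "\<lambda>x. complex_of_real x powr (s - 1) * of_real (1 / (exp x - 1))"
  have w: "Re (s + of_nat k - 1) > 0" for k using s by auto
  have eq: "?f k x = of_real x powr (s - 2) * (fps_nth bern_fps k * of_real x ^ k)" if "x \<in> {0<..1}" for k x
  proof -
    have "s + of_nat k - 1 - 1 = (s - 2) + of_nat k" by simp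
    hence "complex_of_real x powr (s + of_nat k - 1 - 1) = of_real x powr (s - 2) * of_real x ^ k"
      using that by (simp only: powr_add) (simp add: powr_nat')
    thus ?thesis by simp
  qed
  have int: "set_integrable lborel {0<..1} (?f k)" for k
    using integral_powr_unit_interval(1)[OF w] by (rule set_integrable_mult_right) 
  have val: "(LBINT x:{0<..1}. ?f k x) = fps_nth bern_fps k / (s + of_nat k - 1)" for k
    unfolding set_integral_mult_right integral_powr_unit_interval(2)[OF w] by simp
  have norms: "(LBINT x:{0<..1}. norm (?f k x)) = norm (fps_nth bern_fps k) / (Re s + real k - 1)" for k
    unfolding norm_mult set_integral_mult_right integral_powr_unit_interval(3)[OF w] by simp
  have "summable (\<lambda>k. LBINT x:{0<..1}. norm (?f k x))"
    unfolding norms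
  proof (rule summable_comparison_test)
    show "summable (\<lambda>k. norm (fps_nth bern_fps k) / (Re s - 1))"
      by (intro summable_divide summable_bern_fps')
    show "\<exists>N. \<forall>n\<ge>N. norm (norm (fps_nth bern_fps n) / (Re s + real n - 1)) \<le> norm (fps_nth bern_fps n) / (Re s - 1)"
      using s by (auto intro!: divide_left_mono exI[of _ 0])
  qed
  moreover have "(\<lambda>k. ?f k x) sums ?g x" if x: "x \<in> {0<..1}" for x
  proof -
    have "(\<lambda>k. fps_nth bern_fps k * of_real x ^ k) sums (of_real x / (exp (of_real x) - 1))"
      using bern_fps_sums[of "complex_of_real x"] x pi_gt3 by simp
    hence "(\<lambda>k. ?f k x) sums (of_real x powr (s - 2) * (of_real x / (exp (of_real x) - 1)))"
      unfolding eq[OF x] by (rule sums_mult)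
    also have "of_real x powr (s - 2) * (of_real x / (exp (of_real x) - 1)) = ?g x"
    proof -
      have "complex_of_real x powr (s - 1) = complex_of_real x powr (s - 2) * of_real x"
        using x powr_add[of "complex_of_real x" "s - 2" 1] by simp
      thus ?thesis by (simp add: exp_of_real)
    qed
    finally show ?thesis .
  qed
  moreover have "summable (\<lambda>k. norm (?f k x))" if x: "x \<in> {0<..1}" for x
    unfolding eq[OF x] norm_mult[of "of_real x powr (s - 2)"]
    using x pi_gt3 by (intro summable_mult summable_bern_fps) auto
  ultimately show "set_integrable lborel {0<..1} ?g"
    and "(\<lambda>k. fps_nth bern_fps k / (s + of_nat k - 1)) sums (LBINT x:{0<..1}. ?g x)"
    using set_integral_sums[of lborel "{0<..1}" ?f ?g] int unfolding val by auto
qed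

lemma exp_minus_1_bound: "x \<ge> (1::real) \<Longrightarrow> 1 / (exp x - 1) \<le> 2 * exp (- x)"
  and exp_minus_1_pos: "x > (0::real) \<Longrightarrow> 1 / (exp x - 1) > 0"
proof -
  assume x: "x \<ge> 1"
  have "exp x \<ge> 2" using exp_ge_add_one_self[of x] x by linarith
  hence "1 / (exp x - 1) \<le> 1 / (exp x / 2)"
    using x by (intro divide_left_mono mult_pos_pos) auto
  thus "1 / (exp x - 1) \<le> 2 * exp (- x)" by (simp add: exp_minus inverse_eq_divide)
qed auto

text \<open>Away from \<open>0\<close> the kernel decays exponentially, so the integral converges for every exponent.\<close>
lemma bose_integral_tail:
  fixes a :: real
  shows "set_integrable lborel {1<..} (\<lambda>x. x powr (a - 1) * (1 / (exp x - 1)))"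
proof -
  have "set_integrable lborel {0<..} (\<lambda>x. 2 * (x powr (max a 1 - 1) * exp (- 1 * x)))"
    by (intro set_integrable_mult_right gamma_integral_scaled_real) auto
  hence int: "set_integrable lborel {1<..} (\<lambda>x. 2 * (x powr (max a 1 - 1) * exp (- 1 * x)))"
    by (rule set_integrable_subset) auto
  \<comment> \<open>The exponent is raised to at least 0, so that the majorant is a convergent Gamma integral over \<open>{0<..}\<close>.\<close>
  have "norm (x powr (a - 1) * (1 / (exp x - 1))) \<le> norm (2 * (x powr (max a 1 - 1) * exp (- 1 * x)))"
    if "x \<in> {1<..}" for x
  proof -
    have "x powr (a - 1) * (1 / (exp x - 1)) \<le> x powr (max a 1 - 1) * (2 * exp (- x))"
      using that exp_minus_1_bound[of x] exp_minus_1_pos[of x] by (intro mult_mono powr_mono) auto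
    thus ?thesis using that by (simp add: abs_mult)
  qed
  thus ?thesis
    by (intro set_integrable_bound[OF int]) (auto simp: set_borel_measurable_def)
qed

lemma bose_integral_tail_holomorphic:
  "(\<lambda>s::complex. LBINT x:{1<..}. of_real x powr (s - 1) * of_real (1 / (exp x - 1))) holomorphic_on A"
proof -
  let ?I = "(\<lambda>s::complex. LBINT x:{1<..}. of_real x powr (s - 1) * of_real (1 / (exp x - 1)))"
  have "?I field_differentiable (at s)" for s
  proof -
    have "?I holomorphic_on {t. Re t > Re s - 1}"
      by (intro mellin_holomorphic bose_integral_tail) auto
    thus ?thesis
      by (rule holomorphic_on_imp_differentiable_at) (auto simp: open_halfspace_Re_gt)
  qed
  thus ?thesis
    by (auto simp: holomorphic_on_def field_differentiable_at_within)
qed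

lemma summable_Suc_powr:
  assumes "\<sigma> > (1::real)" shows "summable (\<lambda>n. 1 / real (Suc n) powr \<sigma>)"
proof -
  have "summable (\<lambda>n. real n powr (-\<sigma>))"
    using assms by (simp add: summable_real_powr_iff)
  hence "summable (\<lambda>n. real (Suc n) powr (-\<sigma>))"
    by (subst summable_Suc_iff)
  thus ?thesis by (simp add: powr_minus_divide)
qed

text \<open>Expand \<open>1 / (exp x - 1)\<close> into the geometric series \<open>\<Sum>n. exp (-(n + 1) * x)\<close>.\<close>
lemma bose_integral:
  fixes s :: complex
  assumes s: "Re s > 1"
  shows "(\<lambda>n. Gamma s / of_nat (Suc n) powr s) sums
           (LBINT x:{0<..}. of_real x powr (s - 1) * of_real (1 / (exp x - 1)))"
proof -
  let ?f = "\<lambda>n x. complex_of_real x powr (s - 1) * of_real (exp (- real (Suc n) * x))"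
  let ?g = "\<lambda>x. complex_of_real x powr (s - 1) * of_real (1 / (exp x - 1))"
  have int: "set_integrable lborel {0<..} (?f n)" for n
    using s by (intro gamma_integral_scaled) auto
  have val: "(LBINT x:{0<..}. ?f n x) = Gamma s / of_nat (Suc n) powr s" for n
    using s by (subst gamma_integral_scaled) auto
  have norms: "(LBINT x:{0<..}. norm (?f n x)) = Gamma (Re s) / real (Suc n) powr Re s" for n
  proof -
    have "(LBINT x:{0<..}. norm (?f n x)) = (LBINT x:{0<..}. x powr (Re s - 1) * exp (- real (Suc n) * x))"
      by (intro set_lebesgue_integral_cong) (auto simp: norm_mult norm_powr_of_real)
    also have "\<dots> = Gamma (Re s) / real (Suc n) powr Re s"
      using s by (intro gamma_integral_scaled_real) auto
    finally show ?thesis .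
  qed
  have "summable (\<lambda>n. Gamma (Re s) * (1 / real (Suc n) powr Re s))"
    by (intro summable_mult summable_Suc_powr s)
  hence summ: "summable (\<lambda>n. LBINT x:{0<..}. norm (?f n x))" unfolding norms by simp
  have geo: "(\<lambda>n. exp (- real (Suc n) * x)) sums (1 / (exp x - 1))" if "x > 0" for x :: real
  proof -
    have "(\<lambda>n. exp (-x) * exp (-x) ^ n) sums (exp (-x) * (1 / (1 - exp (-x))))"
      using that by (intro sums_mult geometric_sums) auto
    moreover have "exp (-x) * exp (-x) ^ n = exp (- real (Suc n) * x)" for n
      by (simp add: algebra_simps flip: exp_of_nat_mult exp_add)
    moreover have "exp (-x) * (1 / (1 - exp (-x))) = 1 / (exp x - 1)"
      using that by (simp add: exp_minus divide_simps) 
    ultimately show ?thesis by simp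
  qed
  have sums: "(\<lambda>n. ?f n x) sums ?g x" if "x \<in> {0<..}" for x
    using that by (intro sums_mult sums_of_real geo) auto
  have "summable (\<lambda>n. norm (?f n x))" if "x \<in> {0<..}" for x
    unfolding norm_mult using sums_summable[OF geo[of x]] that by (intro summable_mult) auto
  thus ?thesis
    using set_integral_sums(2)[of lborel "{0<..}" ?f ?g] int sums summ unfolding val by auto
qed

section \<open>Analytic continuation of the zeta function\<close>

text \<open>The representation of \<open>\<zeta>\<close> by the integral with kernel \<open>1 / (exp x - 1)\<close>, with the part over \<open>{0<..1}\<close>
  replaced by the series it equals for \<open>Re s > 1\<close>.\<close>
definition zeta_cont :: "complex \<Rightarrow> complex" where
  "zeta_cont s = (\<Sum>k. fps_nth bern_fps k * bern_term k s) +
     rGamma s * (LBINT x:{1<..}. of_real x powr (s - 1) * of_real (1 / (exp x - 1)))"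

lemma zeta_cont_holomorphic: "zeta_cont holomorphic_on (- {1})"
  unfolding zeta_cont_def
  by (intro holomorphic_intros holomorphic_bern_sum bose_integral_tail_holomorphic)

lemma zeta_cont_sums:
  assumes s: "Re s > 1"
  shows "(\<lambda>n. 1 / of_nat (Suc n) powr s) sums zeta_cont s"
proof -
  let ?g = "\<lambda>x. complex_of_real x powr (s - 1) * of_real (1 / (exp x - 1))"
  have "set_integrable lborel {1<..} ?g"
  proof (rule set_integrable_bound[OF bose_integral_tail[of "Re s"]])
    have "set_borel_measurable borel {1<..} ?g"
      unfolding set_borel_measurable_def
    proof (intro borel_measurable_continuous_on_indicator continuous_on_mult continuous_on_powr_of_real continuous_on_of_real)
      show "continuous_on {1<..} (\<lambda>x::real. 1 / (exp x - 1))"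
        by (intro continuous_intros) auto
    qed auto
    thus "set_borel_measurable lborel {1<..} ?g" by (simp add: set_borel_measurable_def)
    have "norm (?g x) = norm (x powr (Re s - 1) * (1 / (exp x - 1)))" if "x \<in> {1<..}" for x
      unfolding norm_mult norm_of_real using that by (simp add: norm_powr_of_real)
    thus "AE x in lborel. x \<in> {1<..} \<longrightarrow> norm (?g x) \<le> norm (x powr (Re s - 1) * (1 / (exp x - 1)))"
      by (intro AE_I2 impI eq_refl)
  qed
  hence "(LBINT x:{0<..1} \<union> {1<..}. ?g x) = (LBINT x:{0<..1}. ?g x) + (LBINT x:{1<..}. ?g x)"
    using s by (intro set_integral_Un bose_integral_unit_interval) auto
  also have "{0<..1} \<union> {1<..} = {0::real<..}" by auto
  finally have split: "(LBINT x:{0<..}. ?g x) = (LBINT x:{0<..1}. ?g x) + (LBINT x:{1<..}. ?g x)" .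
  have ne: "s + of_nat k - 1 \<noteq> 0" for k
    using s by (auto simp: complex_eq_iff)
  have "(\<lambda>k. rGamma s * (fps_nth bern_fps k / (s + of_nat k - 1))) sums (rGamma s * (LBINT x:{0<..1}. ?g x))"
    by (intro sums_mult bose_integral_unit_interval s)
  hence "(\<Sum>k. fps_nth bern_fps k * bern_term k s) = rGamma s * (LBINT x:{0<..1}. ?g x)"
    using ne by (simp add: sums_iff bern_term_eq mult_ac)
  hence "zeta_cont s = rGamma s * (LBINT x:{0<..}. ?g x)"
    unfolding zeta_cont_def split by (simp add: algebra_simps)
  moreover have "s \<notin> \<int>\<^sub>\<le>\<^sub>0" using s by (auto elim!: nonpos_Ints_cases)
  hence "rGamma s * Gamma s = 1" by (simp add: rGamma_inverse_Gamma Gamma_eq_zero_iff)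
  hence "rGamma s * (Gamma s / z) = 1 / z" for z by (metis times_divide_eq_right)
  moreover have "(\<lambda>n. rGamma s * (Gamma s / of_nat (Suc n) powr s)) sums (rGamma s * (LBINT x:{0<..}. ?g x))"
    by (intro sums_mult bose_integral s)
  ultimately show ?thesis by (simp only:)
qed

text \<open>The choice in the definition of \<open>zeta\<close> is not vacuous: \<open>zeta_cont\<close> is a witness.\<close>
lemma zeta_spec: "zeta holomorphic_on (- {1}) \<and> (\<forall>s. Re s > 1 \<longrightarrow> zeta s = (\<Sum>n. 1 / of_nat (Suc n) powr s))"
  unfolding zeta_def
  by (rule someI[of _ zeta_cont]) (use zeta_cont_holomorphic zeta_cont_sums in \<open>auto simp: sums_iff\<close>)

lemma zeta_holomorphic: "zeta holomorphic_on (- {1})"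
  using zeta_spec by blast

lemma zeta_sums: "Re s > 1 \<Longrightarrow> (\<lambda>n. 1 / of_nat (Suc n) powr s) sums zeta s"
  using zeta_spec zeta_cont_sums by (simp add: sums_iff)

lemma zeta_eq_zeta_cont:
  assumes "s \<noteq> 1" shows "zeta s = zeta_cont s"
proof (rule analytic_continuation_open[where s = "{s. Re s > 1}" and s' = "- {1}" and f = zeta and g = zeta_cont])
  show "{s::complex. Re s > 1} \<noteq> {}" by (auto intro: exI[of _ 2])
  show "connected (- {1::complex})" by (rule connected_punctured_universe) simp
  show "zeta z = zeta_cont z" if "z \<in> {s. Re s > 1}" for z
    using zeta_sums[of z] zeta_cont_sums[of z] that sums_unique2 by auto
qed (use assms zeta_holomorphic zeta_cont_holomorphic in \<open>auto simp: open_halfspace_Re_gt\<close>)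

text \<open>Here \<open>rGamma 0 = 0\<close> removes the integral and the term for \<open>k = 0\<close>, and \<open>pochhammer 0 (k - 1) = 0\<close>
  the terms for \<open>k \<ge> 2\<close>.\<close>
lemma zeta_at_0: "zeta 0 = - 1 / 2"
proof -
  have "bern_term k 0 = (if k = 1 then 1 else 0)" for k
    by (auto simp: bern_term_def pochhammer_0_left)
  hence "(\<lambda>k. fps_nth bern_fps k * bern_term k 0) = (\<lambda>k. if k = 1 then fps_nth bern_fps k else 0)"
    by (auto simp: fun_eq_iff)
  hence "zeta_cont 0 = fps_nth bern_fps 1"
    using sums_unique[OF sums_single[of 1 "fps_nth bern_fps"]] by (simp add: zeta_cont_def)
  thus ?thesis by (simp add: zeta_eq_zeta_cont bern_fps_1 del: One_nat_def)
qed

section \<open>Moments of the logistic density\<close>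

text \<open>Removing twice the terms with even base \<open>n + 1\<close> from the Dirichlet series flips their sign; these terms
  alone sum to \<open>2 powr (-s) * zeta s\<close>.\<close>
lemma alternating_zeta_sums:
  assumes s: "Re s > 1"
  shows "(\<lambda>n. (-1) ^ n / of_nat (Suc n) powr s) sums ((1 - 2 powr (1 - s)) * zeta s)"
proof -
  let ?a = "\<lambda>n. 1 / of_nat (Suc n) powr s"
  define b where "b = (\<lambda>n. if odd n then 2 * ?a n else 0)"
  have "b (2 * n + 1) = 2 powr (1 - s) * ?a n" for n
  proof -
    have "of_nat (Suc (2 * n + 1)) = complex_of_real 2 * of_real (real (Suc n))" by simp
    also have "\<dots> powr s = 2 powr s * of_nat (Suc n) powr s"
      by (subst powr_times_real) auto
    finally show ?thesis by (simp add: b_def powr_diff)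
  qed
  hence "(\<lambda>n. b (2 * n + 1)) sums (2 powr (1 - s) * zeta s)"
    using sums_mult[OF zeta_sums[OF s], of "2 powr (1 - s)"] by simp
  also have "?this \<longleftrightarrow> b sums (2 powr (1 - s) * zeta s)"
    by (rule sums_mono_reindex) (auto simp: strict_mono_def b_def elim!: oddE)
  finally have "(\<lambda>n. ?a n - b n) sums (zeta s - 2 powr (1 - s) * zeta s)"
    by (intro sums_diff zeta_sums s)
  moreover have "?a n - b n = (-1) ^ n / of_nat (Suc n) powr s" for n
    by (auto simp: b_def)
  ultimately show ?thesis by (simp add: algebra_simps)
qed

text \<open>The density of the standard logistic distribution.\<close>
definition logistic_density :: "real \<Rightarrow> real" where
  "logistic_density x = exp (- x) / (1 + exp (- x))\<^sup>2"

lemma logistic_density_measurable [measurable]: "logistic_density \<in> borel_measurable borel"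
  unfolding logistic_density_def by measurable

lemma logistic_density_nonneg: "logistic_density x \<ge> 0"
  by (simp add: logistic_density_def)

lemma logistic_moment_integrable:
  assumes "a > 0"
  shows "set_integrable lborel {0<..} (\<lambda>x. x powr (a - 1) * logistic_density x)"
proof -
  have "set_integrable lborel {0<..} (\<lambda>x. x powr (a - 1) * exp (- 1 * x))"
    using assms by (intro gamma_integral_scaled_real) auto
  moreover have "logistic_density x \<le> exp (- x)" for x
  proof -
    have pos: "1 + exp (- x) > 0" by (simp add: add_pos_pos)
    have "1 + exp (- x) > 1" by simp
    hence "(1 + exp (- x))\<^sup>2 \<ge> 1" by (smt (verit) one_le_power)
    hence "exp (- x) / (1 + exp (- x))\<^sup>2 \<le> exp (- x) / 1"
      using pos by (intro divide_left_mono mult_pos_pos zero_less_power) auto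
    thus ?thesis by (simp add: logistic_density_def)
  qed
  hence "norm (x powr (a - 1) * logistic_density x) \<le> norm (x powr (a - 1) * exp (- 1 * x))" for x
    using logistic_density_nonneg[of x] by (auto simp: abs_mult intro!: mult_left_mono)
  ultimately show ?thesis
    by (intro set_integrable_bound[of _ _ _ "\<lambda>x. x powr (a - 1) * logistic_density x"]) (auto simp: set_borel_measurable_def)
qed

text \<open>With \<open>q = exp (-x)\<close> the density is \<open>\<Sum>n. (-1) ^ n * (n + 1) * q ^ (n + 1)\<close>, the derivative of a
  geometric series. The \<open>n\<close>-th term integrates to \<open>(-1) ^ n * \<Gamma>(s + 1) / (n + 1) powr s\<close>.\<close>
lemma logistic_moment_gt_1:
  fixes s :: complex
  assumes s: "Re s > 1"
  shows "(LBINT x:{0<..}. of_real x powr s * of_real (logistic_density x)) =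
           Gamma (s + 1) * ((1 - 2 powr (1 - s)) * zeta s)"
proof -
  let ?f = "\<lambda>n x. ((-1) ^ n * of_nat (Suc n)) * (complex_of_real x powr (s + 1 - 1) * of_real (exp (- real (Suc n) * x)))"
  let ?g = "\<lambda>x. complex_of_real x powr s * of_real (logistic_density x)"
  have int: "set_integrable lborel {0<..} (?f n)" for n
    using s by (intro set_integrable_mult_right gamma_integral_scaled) auto
  have pw: "1 / of_nat (Suc n) powr s = of_nat (Suc n) / complex_of_nat (Suc n) powr (s + 1)" for n
    by (simp add: powr_add)
  have "(LBINT x:{0<..}. ?f n x) = ((-1) ^ n * of_nat (Suc n)) * (Gamma (s + 1) / of_real (real (Suc n)) powr (s + 1))" for n
    unfolding set_integral_mult_right
    using s by (subst gamma_integral_scaled) auto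
  also have "\<dots> n = Gamma (s + 1) * ((-1) ^ n * (of_nat (Suc n) / complex_of_nat (Suc n) powr (s + 1)))" for n
    by simp
  also have "\<dots> n = Gamma (s + 1) * ((-1) ^ n / of_nat (Suc n) powr s)" for n
    unfolding pw[symmetric] by simp
  finally have val: "(LBINT x:{0<..}. ?f n x) = Gamma (s + 1) * ((-1) ^ n / of_nat (Suc n) powr s)" for n .
  have norms: "(LBINT x:{0<..}. norm (?f n x)) = Gamma (Re s + 1) * (1 / real (Suc n) powr Re s)" for n
  proof -
    have "(LBINT x:{0<..}. norm (?f n x)) = (LBINT x:{0<..}. real (Suc n) * (x powr (Re s + 1 - 1) * exp (- real (Suc n) * x)))"
      by (intro set_lebesgue_integral_cong) (auto simp: norm_mult norm_power norm_powr_of_real simp del: of_nat_Suc)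
    also have "\<dots> = real (Suc n) * (Gamma (Re s + 1) / real (Suc n) powr (Re s + 1))"
      unfolding set_integral_mult_right
      using s by (subst gamma_integral_scaled_real) auto
    finally show ?thesis by (simp add: powr_add)
  qed
  have summ: "summable (\<lambda>n. LBINT x:{0<..}. norm (?f n x))"
    unfolding norms by (intro summable_mult summable_Suc_powr s)
  have expn: "exp (- real (Suc n) * x) = exp (-x) * exp (-x) ^ n" for n and x :: real
    by (simp add: algebra_simps flip: exp_of_nat_mult exp_add)
  have sums: "(\<lambda>n. ?f n x) sums ?g x" if "x \<in> {0<..}" for x
  proof -
    have "(\<lambda>n. exp (-x) * (real (Suc n) * (- exp (-x)) ^ n)) sums (exp (-x) * (1 / (1 - (- exp (-x)))\<^sup>2))"
      using that by (intro sums_mult geometric_deriv_sums) auto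
    also have "(\<lambda>n. exp (-x) * (real (Suc n) * (- exp (-x)) ^ n)) = (\<lambda>n. (-1) ^ n * real (Suc n) * exp (- real (Suc n) * x))"
      unfolding expn by (subst power_minus) (simp add: mult_ac)
    finally have "(\<lambda>n. (-1) ^ n * real (Suc n) * exp (- real (Suc n) * x)) sums logistic_density x"
      by (simp add: logistic_density_def)
    hence "(\<lambda>n. of_real x powr s * complex_of_real ((-1) ^ n * real (Suc n) * exp (- real (Suc n) * x))) sums ?g x"
      by (intro sums_mult sums_of_real)
    thus ?thesis by (simp add: mult_ac)
  qed
  have norm_summ: "summable (\<lambda>n. norm (?f n x))" if "x \<in> {0<..}" for x
  proof -
    have "summable (\<lambda>n. x powr Re s * (exp (-x) * (real (Suc n) * exp (-x) ^ n)))"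
      using that by (intro summable_mult sums_summable[OF geometric_deriv_sums]) auto
    moreover have "norm (?f n x) = x powr Re s * (exp (-x) * (real (Suc n) * exp (-x) ^ n))" for n
      using that expn[of n x] by (simp add: norm_mult norm_power norm_powr_of_real del: of_nat_Suc)
    ultimately show ?thesis by simp
  qed
  have "(\<lambda>n. Gamma (s + 1) * ((-1) ^ n / of_nat (Suc n) powr s)) sums (LBINT x:{0<..}. ?g x)"
    using set_integral_sums(2)[of lborel "{0<..}" ?f ?g] int sums summ norm_summ unfolding val by auto
  moreover have "(\<lambda>n. Gamma (s + 1) * ((-1) ^ n / of_nat (Suc n) powr s)) sums (Gamma (s + 1) * ((1 - 2 powr (1 - s)) * zeta s))"
    by (intro sums_mult alternating_zeta_sums s)
  ultimately show ?thesis by (rule sums_unique2)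
qed

text \<open>The integral converges, and hence is holomorphic, for \<open>Re s > -1\<close>; the identity theorem extends the
  formula from \<open>Re s > 1\<close>.\<close>
lemma logistic_moment:
  fixes s :: complex
  assumes s: "Re s > -1" "s \<noteq> 1"
  shows "(LBINT x:{0<..}. of_real x powr s * of_real (logistic_density x)) =
           Gamma (s + 1) * ((1 - 2 powr (1 - s)) * zeta s)"
proof -
  let ?I = "\<lambda>s::complex. LBINT x:{0<..}. of_real x powr s * of_real (logistic_density x)"
  let ?J = "\<lambda>s::complex. LBINT x:{0<..}. of_real x powr (s - 1) * of_real (logistic_density x)"
  let ?S = "{s::complex. Re s > -1} - {1}"
  show ?thesis
  proof (rule analytic_continuation_open[where s = "{s. Re s > 1}" and s' = ?S and f = ?I])
    have "?J holomorphic_on {s. Re s > 0}"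
      by (intro mellin_holomorphic logistic_moment_integrable) auto
    hence "(?J \<circ> (\<lambda>s. s + 1)) holomorphic_on ?S"
      by (intro holomorphic_on_compose_gen[where g = ?J and t = "{s. Re s > 0}"] holomorphic_intros) auto
    thus "?I holomorphic_on ?S" by (simp add: o_def)
    have "zeta holomorphic_on ?S"
      by (rule holomorphic_on_subset[OF zeta_holomorphic]) auto
    moreover have "z + 1 \<notin> \<int>\<^sub>\<le>\<^sub>0" if "Re z > -1" for z :: complex
      using that by (auto elim!: nonpos_Ints_cases simp: complex_eq_iff)
    ultimately show "(\<lambda>s. Gamma (s + 1) * ((1 - 2 powr (1 - s)) * zeta s)) holomorphic_on ?S"
      by (intro holomorphic_intros) auto
    show "{s::complex. Re s > 1} \<noteq> {}" by (auto intro: exI[of _ 2])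
    have "convex {s::complex. Re s > -1}" by (rule convex_halfspace_Re_gt)
    moreover have op: "open {s::complex. Re s > -1}" by (rule open_halfspace_Re_gt)
    moreover have "(0::complex) \<in> {s. Re s > -1}" by simp
    hence "{s::complex. Re s > -1} \<noteq> {}" by blast
    hence "aff_dim {s::complex. Re s > -1} = 2"
      using aff_dim_open[OF op] by simp
    ultimately show "connected ?S" by (intro connected_punctured_convex) auto
    show "open ?S" using op by auto
  qed (use s in \<open>auto simp: open_halfspace_Re_gt logistic_moment_gt_1\<close>)
qed

lemma logistic_moment_real:
  fixes s :: real
  assumes s: "s > -1" "s \<noteq> 1"
  shows "complex_of_real (LBINT x:{0<..}. x powr s * logistic_density x) =
           of_real (Gamma (s + 1) * (1 - 2 powr (1 - s))) * zeta (of_real s)"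
proof -
  have "complex_of_real (LBINT x:{0<..}. x powr s * logistic_density x) =
        (LBINT x:{0<..}. of_real x powr of_real s * of_real (logistic_density x))"
    unfolding set_integral_complex_of_real[symmetric]
    by (intro set_lebesgue_integral_cong) (auto simp: powr_of_real)
  also have "\<dots> = Gamma (of_real s + 1) * ((1 - 2 powr (1 - of_real s)) * zeta (of_real s))"
    using s by (intro logistic_moment) (auto simp: complex_eq_iff)
  also have "Gamma (of_real s + 1) = complex_of_real (Gamma (s + 1))"
    using Gamma_complex_of_real[of "s + 1"] by simp
  also have "2 powr (1 - of_real s) = complex_of_real (2 powr (1 - s))"
    using powr_of_real[of 2 "1 - s"] by simp
  finally show ?thesis by simp
qed

lemma zeta_eq_logistic_moment:
  fixes s :: real
  assumes s: "s > -1" "s \<noteq> 1"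
  shows "zeta (of_real s) = of_real ((LBINT x:{0<..}. x powr s * logistic_density x) / (Gamma (s + 1) * (1 - 2 powr (1 - s))))"
proof -
  have "Gamma (s + 1) > 0" using s by (intro Gamma_real_pos) auto
  moreover have "2 powr (1 - s) \<noteq> 1" using s by (simp add: powr_eq_one_iff_gen)
  ultimately have "complex_of_real (Gamma (s + 1) * (1 - 2 powr (1 - s))) \<noteq> 0" by simp
  thus ?thesis using logistic_moment_real[OF s] by (simp add: eq_divide_eq mult_ac)
qed

lemma Gamma_nat_plus_half:
  "Gamma (real n + 1 / 2) = sqrt pi * (\<Prod>k=1..n. 2 * real k - 1) / 2 ^ n"
proof (induction n)
  case (Suc n)
  have "Gamma (real n + 1 / 2 + 1) = (real n + 1 / 2) * Gamma (real n + 1 / 2)"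
    by (rule Gamma_plus1) (auto elim!: nonpos_Ints_cases)
  also have "real n + 1 / 2 + 1 = real (Suc n) + 1 / 2" by simp
  finally show ?case by (simp only: Suc.IH) (simp add: field_simps)
qed (simp add: Gamma_one_half_real)

lemma LBINT_Ici_eq_Ioi: 
  fixes f :: "real \<Rightarrow> 'a::{banach, second_countable_topology}"
  shows "(LBINT x:{a..}. f x) = (LBINT x:{a<..}. f x)"
  by (rule set_integral_discrete_difference[of "{a}"]) auto

text \<open>The substitution \<open>y = exp x\<close>. The density is even, so \<open>exp x / (1 + exp x)\<^sup>2\<close> is the same function.\<close>
lemma logistic_moment_ln:
  assumes s: "s > -1"
  shows "(LBINT y:{1..}. (ln y) powr s / (1 + y)\<^sup>2) = (LBINT x:{0<..}. x powr s * logistic_density x)"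
proof -
  define f where "f = (\<lambda>y::real. (ln y) powr s / (1 + y)\<^sup>2)"
  have eq: "\<bar>exp x\<bar> * f (exp x) = x powr s * logistic_density x" for x :: real
  proof -
    have "1 + exp x = exp x * (1 + exp (- x))" by (simp add: algebra_simps flip: exp_add)
    hence "exp x / (1 + exp x)\<^sup>2 = logistic_density x"
      by (simp add: logistic_density_def power_mult_distrib exp_minus power2_eq_square inverse_eq_divide)
    moreover have "\<bar>exp x\<bar> * f (exp x) = x powr s * (exp x / (1 + exp x)\<^sup>2)"
      by (simp add: f_def)
    ultimately show ?thesis by (simp only:)
  qed
  have img: "exp ` {0::real<..} = {1<..}"
  proof (intro equalityI subsetI)
    fix y :: real assume "y \<in> {1<..}"
    hence "y = exp (ln y)" "ln y \<in> {0<..}" by auto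
    thus "y \<in> exp ` {0<..}" by (rule image_eqI)
  qed auto
  have int: "set_integrable lborel {0<..} (\<lambda>x. x powr s * logistic_density x)"
    using logistic_moment_integrable[of "s + 1"] s by simp
  hence leb: "set_integrable lebesgue {0<..} (\<lambda>x. x powr s * logistic_density x)"
    unfolding set_integrable_def by (subst integrable_completion) auto
  have "(\<lambda>x. \<bar>exp x\<bar> * f (exp x)) absolutely_integrable_on {0<..} \<and>
        integral {0<..} (\<lambda>x. \<bar>exp x\<bar> * f (exp x)) = (LBINT x:{0<..}. x powr s * logistic_density x) \<longleftrightarrow>
        f absolutely_integrable_on exp ` {0<..} \<and>
        integral (exp ` {0<..}) f = (LBINT x:{0<..}. x powr s * logistic_density x)"
    by (rule has_absolute_integral_change_of_variables_1') (auto intro!: derivative_eq_intros simp: inj_on_def)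
  hence f: "set_integrable lebesgue {1<..} f" "integral {1<..} f = (LBINT x:{0<..}. x powr s * logistic_density x)"
    unfolding eq img using leb set_borel_integral_eq_integral(2)[OF int] by auto
  have "f \<in> borel_measurable borel" unfolding f_def by measurable
  hence "set_integrable lborel {1<..} f"
    using f(1) unfolding set_integrable_def by (subst (asm) integrable_completion) auto
  hence "(LBINT y:{1<..}. f y) = integral {1<..} f"
    by (rule set_borel_integral_eq_integral(2))
  with f(2) show ?thesis unfolding f_def LBINT_Ici_eq_Ioi by simp
qed

section \<open>Special values of the zeta function\<close>

lemma zeta_even:
  "zeta (of_nat (2 * n)) = complex_of_real ((-1) powi (int n - 1) * (2 powi (2 * int n - 1) / fact (2 * n))
             * pi ^ (2 * n) * bernoulli (2 * n))"
proof (cases n)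
  case 0
  have "bernoulli 0 = 1" using bernoulli_conv_bern_fps[of 0] by (simp add: bern_fps_0)
  thus ?thesis using 0 by (simp add: zeta_at_0 power_int_minus)
next
  case (Suc m)
  have exps: "int n - 1 = int m" "2 * int n - 1 = int (2 * m + 1)" using Suc by auto
  have "1 < Re (of_nat (2 * n))" using Suc by simp
  hence "zeta (of_nat (2 * n)) = (\<Sum>k. 1 / of_nat (Suc k) powr (of_nat (2 * n)))"
    using zeta_sums sums_unique by blast
  also have "\<dots> = (\<Sum>k. 1 / of_nat (Suc k) ^ (2 * n))"
    by (subst powr_nat') (auto simp del: of_nat_Suc)
  also have "\<dots> = - ((2 * of_real pi * \<i>) ^ (2 * n) * fps_nth bern_fps (2 * n) / 2)"
    using Suc by (intro sum_inverse_even_powers) auto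
  also have "fps_nth bern_fps (2 * n) = of_real (bernoulli (2 * n)) / fact (2 * n)"
    by (simp add: bernoulli_conv_bern_fps)
  also have "(2 * of_real pi * \<i>) ^ (2 * n) = complex_of_real (- ((-1) ^ m * 2 ^ (2 * m + 1) * 2 * pi ^ (2 * n)))"
  proof -
    have "(2 * of_real pi * \<i>) ^ (2 * n) = ((2 * of_real pi * \<i>)\<^sup>2) ^ n"
      by (rule power_mult)
    also have "(2 * of_real pi * \<i>)\<^sup>2 = complex_of_real (- (2\<^sup>2 * pi\<^sup>2))"
      by (simp add: power_mult_distrib)
    also have "\<dots> ^ n = complex_of_real ((- (2\<^sup>2 * pi\<^sup>2)) ^ n)"
      by (rule of_real_power [symmetric])
    also have "(- (2\<^sup>2 * pi\<^sup>2)) ^ n = (- 1) ^ n * (2 ^ (2 * n) * pi ^ (2 * n))"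
      by (simp only: power_minus[of "2\<^sup>2 * pi\<^sup>2"] power_mult_distrib power_mult)
    also have "\<dots> = - ((-1) ^ m * 2 ^ (2 * m + 1) * 2 * pi ^ (2 * n))"
      by (simp add: Suc)
    finally show ?thesis .
  qed
  finally show ?thesis unfolding exps power_int_of_nat by simp
qed

theorem proposition2p1:
  shows "(\<forall>n::nat. zeta (of_nat (2 * n)) =
           complex_of_real ((-1) powi (int n - 1) * (2 powi (2 * int n - 1) / fact (2 * n))
             * pi ^ (2 * n) * bernoulli (2 * n)))
       \<and> (\<forall>n::nat. n \<ge> 1 \<longrightarrow> zeta (of_real (real n - 1 / 2)) =
           complex_of_real ((2 ^ n * (LBINT y:{1..}. (ln y) powr (real n - 1 / 2) / (1 + y)\<^sup>2))
             / (sqrt pi * (\<Prod>k=1..n. 2 * real k - 1) * (1 - 2 powr (- ((2 * real n - 3) / 2))))))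
       \<and> (\<forall>n::nat. n > 1 \<longrightarrow> zeta (of_nat n) =
           complex_of_real (inverse (1 - 2 powi (1 - int n)) / fact n
             * (LBINT x:{0..}. x ^ n * exp (- x) / (1 + exp (- x))\<^sup>2)))"
proof (intro conjI allI impI)
  fix n :: nat
  show "zeta (of_nat (2 * n)) =
           complex_of_real ((-1) powi (int n - 1) * (2 powi (2 * int n - 1) / fact (2 * n))
             * pi ^ (2 * n) * bernoulli (2 * n))"
    by (rule zeta_even)
next
  fix n :: nat assume n: "n \<ge> 1"
  define s where "s = real n - 1 / 2"
  define I where "I = (LBINT x:{0<..}. x powr s * logistic_density x)"
  have "s \<noteq> 1"
  proof
    assume "s = 1"
    hence "real (2 * n) = real 3" by (simp add: s_def)
    hence "2 * n = 3" by (simp only: of_nat_eq_iff)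
    thus False by presburger
  qed
  moreover have "s > -1" using n by (simp add: s_def)
  moreover have "s + 1 = real n + 1 / 2" by (simp add: s_def)
  ultimately have "zeta (of_real s) = of_real (I / (Gamma (real n + 1 / 2) * (1 - 2 powr (1 - s))))"
    using zeta_eq_logistic_moment[of s] by (simp only: I_def simp_thms)
  also have "1 - s = - ((2 * real n - 3) / 2)" by (simp add: s_def field_simps)
  also have "I = (LBINT y:{1..}. (ln y) powr s / (1 + y)\<^sup>2)"
    unfolding I_def using n by (intro logistic_moment_ln [symmetric]) (simp add: s_def)
  finally show "zeta (of_real (real n - 1 / 2)) =
           complex_of_real ((2 ^ n * (LBINT y:{1..}. (ln y) powr (real n - 1 / 2) / (1 + y)\<^sup>2))
             / (sqrt pi * (\<Prod>k=1..n. 2 * real k - 1) * (1 - 2 powr (- ((2 * real n - 3) / 2)))))"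
    unfolding Gamma_nat_plus_half s_def by (simp add: mult_ac)
next
  fix n :: nat assume n: "n > 1"
  define I where "I = (LBINT x:{0<..}. x powr real n * logistic_density x)"
  have "zeta (of_nat n) = of_real (I / (Gamma (real n + 1) * (1 - 2 powr (1 - real n))))"
    using zeta_eq_logistic_moment[of "real n"] n by (simp add: I_def)
  also have "Gamma (real n + 1) = fact n" using Gamma_fact[of n, where ?'a = real] by (simp add: add.commute)
  also have "2 powr (1 - real n) = (2::real) powi (1 - int n)"
    using powr_real_of_int'[of 2 "1 - int n"] by simp
  also have "I = (LBINT x:{0..}. x ^ n * exp (- x) / (1 + exp (- x))\<^sup>2)"
    unfolding I_def LBINT_Ici_eq_Ioi
    by (intro set_lebesgue_integral_cong) (auto simp: powr_realpow logistic_density_def)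
  finally show "zeta (of_nat n) = complex_of_real (inverse (1 - 2 powi (1 - int n)) / fact n
             * (LBINT x:{0..}. x ^ n * exp (- x) / (1 + exp (- x))\<^sup>2))"
    by (simp add: divide_inverse mult_ac)
qed

end
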